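(* The only filled dihedral groups are $D_{6}$, $D_{8}$, $D_{10}$, $D_{12}$, $D_{14}$ and $D_{22}$. That is, for an integer $n>2$, the dihedral group $D_{2n}$ of order $2n$ is filled if and only if $n\in\{3,4,5,6,7,11\}$.
   Context: $D_{2n}=\langle x,y\mid x^{n}=y^2=1,\ xy=yx^{-1}\rangle$ denotes the dihedral group of order $2n$, where $n>2$. Let $G$ be a finite group. For $S\subseteq G$ write $SS=\{ab : a,b\in S\}$ ($a$ and $b$ not necessarily distinct). A non-empty subset $S$ of $G$ is product-free if $S\cap SS=\varnothing$. A product-free set $S$ is locally maximal if whenever $\Sigma$ is product-free in $G$ and $S\subseteq\Sigma$, then $S=\Sigma$. A product-free set $S$ fills $G$ (equivalently, is complete) if $G^{*}\subseteq S\cup SS$, where $G^{*}$ is the set of non-identity elements of $G$. The group $G$ is filled if every locally maximal product-free set in $G$ fills $G$. *)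

theory Defs
  imports "HOL-Algebra.Algebra"
begin

definition product_free :: "('a, 'b) monoid_scheme \<Rightarrow> 'a set \<Rightarrow> bool"
  where "product_free G S \<longleftrightarrow>
    S \<subseteq> carrier G \<and> S \<noteq> {} \<and> S \<inter> (S <#>\<^bsub>G\<^esub> S) = {}"

definition locally_maximal_product_free :: "('a, 'b) monoid_scheme \<Rightarrow> 'a set \<Rightarrow> bool"
  where "locally_maximal_product_free G S \<longleftrightarrow>
    product_free G S \<and> (\<forall>T. product_free G T \<and> S \<subseteq> T \<longrightarrow> S = T)"

definition fills :: "('a, 'b) monoid_scheme \<Rightarrow> 'a set \<Rightarrow> bool"
  where "fills G S \<longleftrightarrow> carrier G - {\<one>\<^bsub>G\<^esub>} \<subseteq> S \<union> (S <#>\<^bsub>G\<^esub> S)"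

definition filled_group :: "('a, 'b) monoid_scheme \<Rightarrow> bool"
  where "filled_group G \<longleftrightarrow> (\<forall>S. locally_maximal_product_free G S \<longrightarrow> fills G S)"

text \<open>
  \<open>is_dihedral n G\<close> says that \<open>G\<close> is the dihedral group of order \<open>2 * n\<close>, presented as
  \<open>\<langle>x, y | x^n = y^2 = 1, x y = y x^-1\<rangle>\<close>. Every group generated by elements satisfying these
  relations is a quotient of the presented group, which has order \<open>2 * n\<close>; demanding that
  \<open>G\<close> have order \<open>2 * n\<close> therefore determines \<open>G\<close> up to isomorphism as the presented group.
\<close>

definition is_dihedral :: "nat \<Rightarrow> ('a, 'b) monoid_scheme \<Rightarrow> bool"
  where "is_dihedral n G \<longleftrightarrow>
    group G \<and> order G = 2 * n \<and>
    (\<exists>x\<in>carrier G. \<exists>y\<in>carrier G.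
       generate G {x, y} = carrier G \<and>
       x [^]\<^bsub>G\<^esub> n = \<one>\<^bsub>G\<^esub> \<and> y [^]\<^bsub>G\<^esub> (2::nat) = \<one>\<^bsub>G\<^esub> \<and>
       x \<otimes>\<^bsub>G\<^esub> y = y \<otimes>\<^bsub>G\<^esub> inv\<^bsub>G\<^esub> x)"

text \<open>
  Dihedral groups exist: in the following model \<open>(i, b)\<close> stands for \<open>x^i\<close> if \<open>b\<close> is false and
  for \<open>x^i y\<close> if \<open>b\<close> is true.
\<close>

definition dihedral_model :: "nat \<Rightarrow> (int \<times> bool) monoid"
  where "dihedral_model n =
    \<lparr>carrier = {0..<int n} \<times> UNIV,
     monoid.mult = (\<lambda>(i, b) (j, c). ((if b then i - j else i + j) mod int n, b \<noteq> c)),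
     one = (0, False)\<rparr>"

lemma group_dihedral_model:
  assumes "n > 0"
  shows "group (dihedral_model n)"
proof (rule groupI)
  fix u v w
  show "u \<otimes>\<^bsub>dihedral_model n\<^esub> v \<otimes>\<^bsub>dihedral_model n\<^esub> w =
        u \<otimes>\<^bsub>dihedral_model n\<^esub> (v \<otimes>\<^bsub>dihedral_model n\<^esub> w)"
    by (cases u; cases v; cases w)
       (auto simp: dihedral_model_def mod_simps algebra_simps)
next
  fix u assume "u \<in> carrier (dihedral_model n)"
  then show "\<exists>v\<in>carrier (dihedral_model n). v \<otimes>\<^bsub>dihedral_model n\<^esub> u = \<one>\<^bsub>dihedral_model n\<^esub>"
    using assms
    by (intro bexI[of _ "((if snd u then fst u else - fst u) mod int n, snd u)"])
       (auto simp: dihedral_model_def mod_simps)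
qed (use assms in \<open>auto simp: dihedral_model_def\<close>)

lemma is_dihedral_dihedral_model:
  assumes "n > 2"
  shows "is_dihedral n (dihedral_model n)"
proof -
  let ?D = "dihedral_model n"
  let ?x = "(1, False)" and ?y = "(0, True)"
  interpret D: group ?D using assms by (intro group_dihedral_model) simp
  have xy: "?x \<in> carrier ?D" "?y \<in> carrier ?D"
    using assms by (auto simp: dihedral_model_def)
  have pow: "?x [^]\<^bsub>?D\<^esub> k = (int k mod int n, False)" for k :: nat
    by (induction k) (auto simp: dihedral_model_def mod_simps algebra_simps)
  have inv_x: "inv\<^bsub>?D\<^esub> ?x = (int n - 1, False)"
    using assms by (intro D.inv_equality) (auto simp: dihedral_model_def)
  have sub: "subgroup (generate ?D {?x, ?y}) ?D"
    using xy by (intro D.generate_is_subgroup) auto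
  have "(i, b) \<in> generate ?D {?x, ?y}" if "0 \<le> i" "i < int n" for i b
  proof -
    have x: "?x \<in> generate ?D {?x, ?y}" and y: "?y \<in> generate ?D {?x, ?y}"
      by (auto intro: generate.incl)
    have "?x [^]\<^bsub>?D\<^esub> k \<in> generate ?D {?x, ?y}" for k :: nat
      by (induction k) (use sub x in \<open>auto intro: subgroup.m_closed subgroup.one_closed\<close>)
    from this[of "nat i"] have 1: "(i, False) \<in> generate ?D {?x, ?y}"
      using that unfolding pow by simp
    have "(i, True) = (i, False) \<otimes>\<^bsub>?D\<^esub> ?y"
      using that by (simp add: dihedral_model_def)
    also have "\<dots> \<in> generate ?D {?x, ?y}"
      using sub 1 y by (rule subgroup.m_closed)
    finally show ?thesis using 1 by (cases b) auto
  qed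
  then have "carrier ?D \<subseteq> generate ?D {?x, ?y}"
    by (auto simp: dihedral_model_def)
  then have gen: "generate ?D {?x, ?y} = carrier ?D"
    using subgroup.subset[OF sub] by blast
  have "order ?D = 2 * n"
    by (simp add: order_def dihedral_model_def card_cartesian_product)
  moreover have "?x [^]\<^bsub>?D\<^esub> n = \<one>\<^bsub>?D\<^esub>"
    unfolding pow by (simp add: dihedral_model_def)
  moreover have "?y [^]\<^bsub>?D\<^esub> (2::nat) = \<one>\<^bsub>?D\<^esub>"
    by (simp add: numeral_2_eq_2 dihedral_model_def)
  moreover have "?x \<otimes>\<^bsub>?D\<^esub> ?y = ?y \<otimes>\<^bsub>?D\<^esub> inv\<^bsub>?D\<^esub> ?x"
    unfolding inv_x using assms
    by (simp add: dihedral_model_def)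
  ultimately show ?thesis
    unfolding is_dihedral_def using xy gen D.is_group by blast
qed

end

theory Submission
  imports Defs "HOL-Number_Theory.Cong"
begin

text \<open>
  Write \<open>rot i = x^i\<close> and \<open>mir i = x^i y\<close>, with integer indices that matter modulo \<open>n\<close>. Since a
  product of two rotations or of two reflections is a rotation, and a mixed product is a
  reflection, a subset of the dihedral group is a pair of sets \<open>A\<close>, \<open>B\<close> of residues (its
  rotations and its reflections), and it is product-free iff \<open>A\<close> meets neither \<open>A + A\<close> nor
  \<open>B - B\<close>. What keeps a further element from being added is equally explicit: a reflection \<open>c\<close>
  is blocked exactly by \<open>B + A\<close> and \<open>B - A\<close>, and those reflections are products of two elements
  of the set. So a locally maximal product-free set always accounts for all reflections
  (\<open>reflection_cover\<close>), and it fails to fill only by missing a rotation. A rotation \<open>c\<close> is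
  blocked by \<open>A + A\<close> and \<open>B - B\<close>, which consist of products, but also by \<open>A - A\<close> and by
  \<open>2c \<in> A\<close>, which do not; that is how a rotation can be missed.

  A group is not filled once some product-free \<open>S\<close> and some \<open>g \<noteq> 1\<close> are such that no product-free
  set \<open>T\<close> above \<open>S\<close> reaches \<open>g\<close>: a maximal such \<open>T\<close> does not fill. Let \<open>n = 2m + e\<close> with
  \<open>e \<in> {0, 1}\<close>. Take for \<open>A\<close> the integers in the upper half \<open>[m/2, m)\<close> and \<open>B = {0, m}\<close>. The sums
  \<open>A + A\<close> cover about \<open>[m, 2m - 2]\<close>, the differences \<open>A - A\<close> cover \<open>(-m/2, m/2)\<close> roughly,
  so the rotations of \<open>T\<close> are confined to about \<open>[m/2, m)\<close>, where no two of them can add up to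
  the small number \<open>c = 1 + e\<close>. The reflections of \<open>T\<close> are confined to \<open>0, m, m + e, 2m\<close>, and
  \<open>c\<close> is not the difference of two of these. Finally \<open>c\<close> itself is excluded from \<open>T\<close> as it lies
  in \<open>A - A\<close>, provided that \<open>A\<close> is long enough, which means \<open>m \<ge> 4 + 2e\<close>. This covers every
  \<open>n \<ge> 8\<close> except 9 and 11 (\<open>not_filled_generic\<close>), and a similar set handles \<open>n = 9\<close>.

  For \<open>n\<close> among 3, 4, 5, 6, 7, 11 suppose that a locally maximal product-free set misses the
  rotation \<open>c\<close>. Replacing \<open>x\<close> by another generator of the rotations and \<open>y\<close> by another reflection,
  one may assume that \<open>c\<close> divides \<open>n\<close> and that \<open>y\<close> belongs to the set. Nine pairs \<open>(n, c)\<close>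
  remain, and for each of them the conditions on \<open>A\<close> and \<open>B\<close> form a propositional problem in
  at most 22 variables that is unsatisfiable (\<open>no_hole\<close>).
\<close>

section \<open>Coordinates on a dihedral group\<close>

text \<open>
  The maps are indexed by all integers rather than by residues so that index arithmetic is plain
  integer arithmetic, and they are not tied to the generators so that the same facts
  are available for every choice of a generating rotation and of a reflection.
\<close>

locale dihedral_coordinates = group G for G (structure) +
  fixes n :: nat and rot mir :: "int \<Rightarrow> 'a"
  assumes n_pos: "n > 0"
    and carrier_eq: "carrier G = range rot \<union> range mir"
    and rot_rot: "rot i \<otimes> rot j = rot (i + j)"
    and rot_mir: "rot i \<otimes> mir j = mir (i + j)"
    and mir_rot: "mir i \<otimes> rot j = mir (i - j)"
    and mir_mir: "mir i \<otimes> mir j = rot (i - j)"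
    and rot_eq_iff: "rot i = rot j \<longleftrightarrow> [i = j] (mod int n)"
    and mir_eq_iff: "mir i = mir j \<longleftrightarrow> [i = j] (mod int n)"
    and rot_neq_mir: "rot i \<noteq> mir j"
begin

lemma rot_closed [simp]: "rot i \<in> carrier G" and mir_closed [simp]: "mir i \<in> carrier G"
  by (auto simp: carrier_eq)

lemma rot_zero: "rot 0 = \<one>"
  using rot_rot[of 0 0] l_cancel_one'[of "rot 0" "rot 0"] by simp

lemma rot_mod [simp]: "rot (i mod int n) = rot i" and mir_mod [simp]: "mir (i mod int n) = mir i"
  by (simp_all add: rot_eq_iff mir_eq_iff)

lemma finite_carrier: "finite (carrier G)"
proof -
  have *: "i mod int n \<in> {0..<int n}" for i
    using n_pos by simp
  have "rot i \<in> rot ` {0..<int n}" "mir i \<in> mir ` {0..<int n}" for i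
    using imageI[OF *, of rot i] imageI[OF *, of mir i] by simp_all
  then have "carrier G \<subseteq> rot ` {0..<int n} \<union> mir ` {0..<int n}"
    by (auto simp: carrier_eq)
  then show ?thesis
    by (rule finite_subset) simp
qed

text \<open>
  The substitution of \<open>x^k\<close> for \<open>x\<close> and of \<open>x^t y\<close> for \<open>y\<close>, an automorphism of the dihedral
  group.
\<close>

lemma change_coordinates:
  assumes "coprime k (int n)"
  shows "dihedral_coordinates G n (\<lambda>i. rot (k * i)) (\<lambda>i. mir (k * i + t))"
proof unfold_locales
  obtain k' where k': "[k * k' = 1] (mod int n)"
    using cong_solve_coprime_int[OF assms] by blast
  have *: "[i = k * (k' * i)] (mod int n)" for i
    using cong_mult[OF k' cong_refl[of i]] by (simp add: cong_sym mult.assoc)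
  have "rot i \<in> range (\<lambda>i. rot (k * i))" for i
    using * by (metis rot_eq_iff rangeI)
  moreover have "mir i \<in> range (\<lambda>i. mir (k * i + t))" for i
  proof -
    have "mir i = mir (k * (k' * (i - t)) + t)"
      using cong_add[OF *[of "i - t"] cong_refl[of t]] by (simp add: mir_eq_iff)
    then show ?thesis
      by simp
  qed
  ultimately show "carrier G = range (\<lambda>i. rot (k * i)) \<union> range (\<lambda>i. mir (k * i + t))"
    by (auto simp: carrier_eq)
qed (use n_pos rot_neq_mir assms in
    \<open>auto simp: rot_rot rot_mir mir_rot mir_mir rot_eq_iff mir_eq_iff cong_mult_lcancel cong_mult_rcancel
      cong_add_lcancel algebra_simps\<close>)

end

text \<open>
  The relations alone give the multiplication table and show that \<open>rot\<close> and \<open>mir\<close> exhaust the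
  group, each taking at most \<open>n\<close> values. As the order is \<open>2 * n\<close>, these \<open>2 * n\<close> values must be
  pairwise distinct.
\<close>

lemma is_dihedral_coordinates:
  fixes G :: "('a, 'b) monoid_scheme" (structure)
  assumes n: "n > 0" and "is_dihedral n G"
  obtains rot mir where "dihedral_coordinates G n rot mir"
proof -
  interpret group G
    using assms(2) by (simp add: is_dihedral_def)
  obtain x y where x [simp]: "x \<in> carrier G" and y [simp]: "y \<in> carrier G"
    and gen: "generate G {x, y} = carrier G" and xn: "x [^] n = \<one>"
    and y2: "y [^] (2::nat) = \<one>" and xy: "x \<otimes> y = y \<otimes> inv x"
    using assms(2) by (auto simp: is_dihedral_def)
  define rot mir where "rot = (\<lambda>i::int. x [^] i)" and "mir = (\<lambda>i. rot i \<otimes> y)"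
  have [simp]: "rot i \<in> carrier G" "mir i \<in> carrier G" for i
    by (simp_all add: rot_def mir_def)
  have yy: "y \<otimes> y = \<one>"
    using y2 by (simp add: numeral_2_eq_2)
  have rr: "rot i \<otimes> rot j = rot (i + j)" for i j
    by (simp add: rot_def int_pow_mult)
  have r0: "rot 0 = \<one>" and r1: "rot 1 = x" and rm1: "rot (- 1) = inv x"
    by (simp_all add: rot_def int_pow_neg)
  have ry_nat: "rot (int k) \<otimes> y = y \<otimes> rot (- int k)" for k
  proof (induction k)
    case (Suc k)
    have "rot (int (Suc k)) \<otimes> y = x \<otimes> (rot (int k) \<otimes> y)"
      using rr[of 1 "int k"] by (simp add: r1 m_assoc[symmetric])
    also have "\<dots> = y \<otimes> rot (- 1) \<otimes> rot (- int k)"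
      by (simp add: Suc m_assoc[symmetric] xy rm1)
    also have "\<dots> = y \<otimes> rot (- int (Suc k))"
      by (simp add: m_assoc rr)
    finally show ?case .
  qed (simp add: r0)
  have ry: "rot i \<otimes> y = y \<otimes> rot (- i)" for i
  proof (cases i)
    case (nonneg k)
    then show ?thesis by (simp add: ry_nat)
  next
    case (neg k)
    define m where "m = int (Suc k)"
    have "rot (- m) \<otimes> y = rot (- m) \<otimes> (y \<otimes> rot (- m)) \<otimes> rot m"
      by (simp add: m_assoc rr r0)
    also have "\<dots> = y \<otimes> rot m"
      unfolding ry_nat[of "Suc k", folded m_def, symmetric]
      by (simp add: m_assoc[symmetric] rr r0)
    finally show ?thesis
      by (simp only: neg m_def minus_minus)
  qed
  have rm: "rot i \<otimes> mir j = mir (i + j)" for i j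
    by (simp add: mir_def m_assoc[symmetric] rr)
  have mr: "mir i \<otimes> rot j = mir (i - j)" for i j
  proof -
    have "mir i \<otimes> rot j = rot i \<otimes> (rot (- j) \<otimes> y)"
      using ry[of "- j"] by (simp add: mir_def m_assoc)
    then show ?thesis
      by (simp add: mir_def m_assoc[symmetric] rr)
  qed
  have mm: "mir i \<otimes> mir j = rot (i - j)" for i j
  proof -
    have "mir i \<otimes> mir j = mir i \<otimes> rot j \<otimes> y"
      by (simp add: mir_def m_assoc)
    also have "\<dots> = rot (i - j) \<otimes> (y \<otimes> y)"
      unfolding mr by (simp add: mir_def m_assoc)
    finally show ?thesis
      by (simp add: yy)
  qed
  have rn: "rot (int n) = \<one>"
    by (simp add: rot_def int_pow_int xn)
  have rot_cong: "rot i = rot j" if "[i = j] (mod int n)" for i j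
  proof -
    have "rot (int n * k) = \<one>" for k
      using int_pow_pow[OF x, of "int n" k] rn by (simp add: rot_def)
    moreover have "int n dvd j - i"
      using cong_sym[OF that] by (simp add: cong_iff_dvd_diff)
    then obtain k where "j - i = int n * k" ..
    ultimately have "rot (j - i) = \<one>"
      by simp
    then show ?thesis
      using rr[of i "j - i"] by simp
  qed
  let ?I = "{0..<int n}"
  have red: "rot i \<in> rot ` ?I" "mir i \<in> mir ` ?I" for i
    using n rot_cong[of i "i mod int n"] by (auto simp: mir_def intro!: image_eqI[of _ _ "i mod int n"])
  have "subgroup (range rot \<union> range mir) G"
  proof (rule subgroupI)
    fix a assume a: "a \<in> range rot \<union> range mir"
    have "inv (rot i) = rot (- i)" "inv (mir i) = mir i" for i
      by (rule inv_equality; simp add: rr r0 mm)+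
    then show "inv a \<in> range rot \<union> range mir"
      using a by auto
  qed (auto simp: rr rm mr mm)
  moreover have "{x, y} \<subseteq> range rot \<union> range mir"
    using r1 r0 by (auto simp: mir_def image_iff intro: exI[of _ 1] exI[of _ 0])
  ultimately have "carrier G \<subseteq> range rot \<union> range mir"
    using generate_subgroup_incl gen by metis
  then have carrier: "carrier G = range rot \<union> range mir"
    by auto
  also have "\<dots> = rot ` ?I \<union> mir ` ?I"
    using red by auto
  finally have card: "card (rot ` ?I \<union> mir ` ?I) = 2 * n"
    using assms(2) by (simp add: is_dihedral_def order_def)
  have le: "card (rot ` ?I) \<le> n" "card (mir ` ?I) \<le> n"
    using card_image_le[of ?I rot] card_image_le[of ?I mir] by simp_all
  have sum: "card (rot ` ?I) + card (mir ` ?I) = 2 * n + card (rot ` ?I \<inter> mir ` ?I)"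
    using card_Un_Int[of "rot ` ?I" "mir ` ?I"] card by simp
  \<comment> \<open>Both images have at most \<open>n\<close> elements, so neither a collision nor an overlap is possible.\<close>
  then have disj: "rot ` ?I \<inter> mir ` ?I = {}" and "card (rot ` ?I) = card ?I"
    using le by (simp_all flip: card_0_eq)
  then have inj: "inj_on rot ?I"
    by (intro eq_card_imp_inj_on) simp_all
  have rot_eq: "rot i = rot j \<longleftrightarrow> [i = j] (mod int n)" for i j
  proof
    have mod: "rot (k mod int n) = rot k" for k
      by (rule rot_cong) simp
    assume "rot i = rot j"
    then have "rot (i mod int n) = rot (j mod int n)"
      by (simp only: mod)
    from inj_onD[OF inj this] show "[i = j] (mod int n)"
      using n by (simp add: cong_def)
  qed (rule rot_cong)
  have "dihedral_coordinates G n rot mir"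
  proof unfold_locales
    show "rot i \<noteq> mir j" for i j
      using red disj by (metis disjoint_iff)
    show "mir i = mir j \<longleftrightarrow> [i = j] (mod int n)" for i j
      unfolding mir_def rot_eq[symmetric] by simp
  qed (fact n carrier rr rm mr mm rot_eq)+
  then show ?thesis ..
qed

section \<open>Product-free sets in coordinates\<close>

context dihedral_coordinates
begin

lemma rot_mem_square_iff:
  assumes "S \<subseteq> carrier G"
  shows "rot c \<in> S <#> S \<longleftrightarrow>
    (\<exists>i. rot i \<in> S \<and> rot (c - i) \<in> S) \<or> (\<exists>i. mir i \<in> S \<and> mir (c + i) \<in> S)" (is "?L \<longleftrightarrow> ?R")
proof
  assume ?L
  then obtain g h where gh: "g \<in> S" "h \<in> S" "rot c = g \<otimes> h"
    by (auto simp: set_mult_def)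
  moreover have "g \<in> range rot \<union> range mir" "h \<in> range rot \<union> range mir"
    using gh(1,2) assms by (auto simp: carrier_eq)
  ultimately consider (XX) i j where "g = rot i" "h = rot j" | (XY) i j where "g = rot i" "h = mir j"
    | (YX) i j where "g = mir i" "h = rot j" | (YY) i j where "g = mir i" "h = mir j"
    by blast
  then show ?R
  proof cases
    case XX
    then have "[c = i + j] (mod int n)"
      using gh by (simp add: rot_rot rot_eq_iff)
    from cong_diff[OF this cong_refl[of i]] have "[j = c - i] (mod int n)"
      by (simp add: cong_sym)
    then show ?thesis
      using gh XX by (metis rot_eq_iff)
  next
    case YY
    then have "[c = i - j] (mod int n)"
      using gh by (simp add: mir_mir rot_eq_iff)
    from cong_add[OF this cong_refl[of j]] have "[i = c + j] (mod int n)"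
      by (simp add: cong_sym)
    then show ?thesis
      using gh YY by (metis mir_eq_iff)
  qed (use gh rot_neq_mir in \<open>auto simp: rot_mir mir_rot\<close>)
next
  have *: "rot c = rot i \<otimes> rot (c - i)" "rot c = mir (c + i) \<otimes> mir i" for i
    by (simp_all add: rot_rot mir_mir)
  assume ?R
  then show ?L
    unfolding set_mult_def using *[symmetric] by (smt (verit) UN_I singletonI)
qed

lemma mir_mem_squareI:
  assumes "rot i \<in> S" and "mir (c - i) \<in> S \<or> mir (c + i) \<in> S"
  shows "mir c \<in> S <#> S"
proof -
  have "mir c = rot i \<otimes> mir (c - i)" "mir c = mir (c + i) \<otimes> rot i"
    by (simp_all add: rot_mir mir_rot)
  then show ?thesis
    unfolding set_mult_def using assms by (metis UN_I singletonI)
qed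

text \<open>
  The condition that a mixed product is not a reflection of \<open>S\<close> is already contained in
  the condition on two reflections: \<open>mir j\<close> and \<open>mir (i + j)\<close> lie in \<open>S\<close> only if \<open>rot i\<close> does not.
\<close>

lemma product_free_iff:
  "product_free G S \<longleftrightarrow> S \<subseteq> carrier G \<and> S \<noteq> {} \<and>
    (\<forall>i j. rot i \<in> S \<longrightarrow> rot j \<in> S \<longrightarrow> rot (i + j) \<notin> S) \<and>
    (\<forall>i j. mir i \<in> S \<longrightarrow> mir j \<in> S \<longrightarrow> rot (i - j) \<notin> S)" (is "_ \<longleftrightarrow> ?R")
proof
  assume pf: "product_free G S"
  have "g \<otimes> h \<notin> S" if "g \<in> S" "h \<in> S" for g h
    using pf that unfolding product_free_def set_mult_def by blast
  then show ?R
    using pf unfolding product_free_def by (metis rot_rot mir_mir)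
next
  assume R: ?R
  have "g \<otimes> h \<notin> S" if "g \<in> S" "h \<in> S" for g h
  proof -
    have "g \<in> range rot \<union> range mir" "h \<in> range rot \<union> range mir"
      using R that by (auto simp: carrier_eq)
    moreover have "mir (i + j) \<notin> S" if "rot i \<in> S" "mir j \<in> S" for i j
      using R that by (metis add_diff_cancel_right')
    moreover have "mir (i - j) \<notin> S" if "mir i \<in> S" "rot j \<in> S" for i j
      using R that by (metis diff_diff_eq2 add_diff_cancel_left')
    ultimately show ?thesis
      using R that by (auto simp: rot_rot rot_mir mir_rot mir_mir)
  qed
  then show "product_free G S"
    using R by (auto simp: product_free_def set_mult_def)
qed

lemma product_freeD:
  assumes "product_free G S"
  shows "rot i \<in> S \<Longrightarrow> rot j \<in> S \<Longrightarrow> rot (i + j) \<notin> S"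
    and "mir i \<in> S \<Longrightarrow> mir j \<in> S \<Longrightarrow> rot (i - j) \<notin> S"
  using assms unfolding product_free_iff by blast+

lemma rot_zero_notin:
  assumes "product_free G S"
  shows "rot 0 \<notin> S"
  using product_freeD(1)[OF assms, of 0 0] by auto

text \<open>
  If \<open>mir c\<close> cannot be added to \<open>S\<close>, then some rotation of \<open>S\<close> is the quotient of two
  reflections, one of which is \<open>mir c\<close>; so \<open>mir c\<close> is the product of that rotation and the other
  reflection. It cannot be that both are \<open>mir c\<close>, as the identity is not in \<open>S\<close>.
\<close>

lemma reflection_cover:
  assumes "locally_maximal_product_free G S" and "mir c \<notin> S"
  shows "\<exists>i. rot i \<in> S \<and> (mir (c - i) \<in> S \<or> mir (c + i) \<in> S)"
proof -
  let ?T = "insert (mir c) S"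
  have pf: "product_free G S"
    using assms by (simp add: locally_maximal_product_free_def)
  have "\<not> product_free G ?T"
    using assms by (auto simp: locally_maximal_product_free_def)
  moreover have "rot i \<in> ?T \<longleftrightarrow> rot i \<in> S" for i
    using rot_neq_mir by auto
  moreover have "?T \<subseteq> carrier G"
    using pf by (auto simp: product_free_def)
  ultimately obtain i j where ij: "mir i \<in> ?T" "mir j \<in> ?T" "rot (i - j) \<in> S"
    using pf unfolding product_free_iff by blast
  have "mir i \<in> S \<or> mir j \<in> S"
  proof (rule ccontr)
    assume "\<not> ?thesis"
    then have "[i = j] (mod int n)"
      using ij by (metis mir_eq_iff insert_iff)
    then have "rot (i - j) = rot 0"
      by (simp add: rot_eq_iff cong_iff_dvd_diff)
    then show False
      using ij rot_zero_notin[OF pf] by simp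
  qed
  moreover have "\<not> (mir i \<in> S \<and> mir j \<in> S)"
    using product_freeD(2)[OF pf] ij by blast
  ultimately consider "mir i = mir c" "mir j \<in> S" | "mir j = mir c" "mir i \<in> S"
    using ij by auto
  then show ?thesis
  proof cases
    case 1
    then have "[c - (i - j) = i - (i - j)] (mod int n)"
      by (intro cong_diff cong_refl) (simp add: mir_eq_iff cong_sym)
    then have "mir (c - (i - j)) \<in> S"
      using 1 by (simp flip: mir_eq_iff)
    then show ?thesis
      using ij by blast
  next
    case 2
    then have "[c + (i - j) = j + (i - j)] (mod int n)"
      by (intro cong_add cong_refl) (simp add: mir_eq_iff cong_sym)
    then have "mir (c + (i - j)) \<in> S"
      using 2 by (simp flip: mir_eq_iff)
    then show ?thesis
      using ij by blast
  qed
qed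

text \<open>
  In contrast to reflections, a rotation that cannot be added need not be a product of two
  elements of \<open>S\<close>: it may also be half of a rotation in \<open>S\<close>, or a difference of two of them.
\<close>

lemma rotation_cover:
  assumes "locally_maximal_product_free G S" and "rot c \<notin> S" and "rot c \<noteq> \<one>"
  shows "rot (2 * c) \<in> S \<or> (\<exists>i. rot i \<in> S \<and> (rot (c - i) \<in> S \<or> rot (c + i) \<in> S)) \<or>
    (\<exists>i. mir i \<in> S \<and> mir (c + i) \<in> S)"
proof (rule ccontr)
  assume no: "\<not> ?thesis"
  let ?T = "insert (rot c) S"
  have pf: "product_free G S"
    using assms by (simp add: locally_maximal_product_free_def)
  have sub: "S \<subseteq> carrier G"
    using pf by (simp add: product_free_def)
  have mir_iff: "mir i \<in> ?T \<longleftrightarrow> mir i \<in> S" for i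
    using rot_neq_mir by (metis insert_iff)
  have rot_iff: "rot i \<in> ?T \<longleftrightarrow> [i = c] (mod int n) \<or> rot i \<in> S" for i
    by (simp add: rot_eq_iff)
  have 1: "rot (i + j) \<notin> ?T" if "rot i \<in> S" "rot j \<in> ?T" for i j
  proof
    assume *: "rot (i + j) \<in> ?T"
    have "rot (i + j) \<notin> S" if "rot j \<in> S"
      using product_freeD(1)[OF pf] that \<open>rot i \<in> S\<close> by blast
    moreover have False if "[j = c] (mod int n)" "rot (i + j) \<in> S"
    proof -
      have "rot (c + i) = rot (i + j)"
        using that cong_add[OF cong_refl[of i] that(1)]
        by (simp add: rot_eq_iff add.commute cong_sym)
      then show False
        using no that \<open>rot i \<in> S\<close> by metis
    qed
    moreover have False if "[i + j = c] (mod int n)" "rot j \<in> S"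
    proof -
      have "rot (c - i) = rot j"
        using cong_diff[OF that(1) cong_refl[of i]] by (simp add: rot_eq_iff cong_sym)
      then show False
        using no that \<open>rot i \<in> S\<close> by metis
    qed
    moreover have False if "[j = c] (mod int n)" "[i + j = c] (mod int n)"
    proof -
      have "[i = 0] (mod int n)"
        using cong_diff[OF that(2,1)] by simp
      then show False
        using rot_zero_notin[OF pf] \<open>rot i \<in> S\<close> by (metis rot_eq_iff)
    qed
    ultimately show False
      using * \<open>rot j \<in> ?T\<close> rot_iff by blast
  qed
  have 2: "rot (i + j) \<notin> ?T" if "[i = c] (mod int n)" "[j = c] (mod int n)" for i j
  proof
    have ij: "[i + j = 2 * c] (mod int n)"
      using cong_add[OF that] by simp
    assume "rot (i + j) \<in> ?T"
    then consider "rot (2 * c) \<in> S" | "[2 * c = c] (mod int n)"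
      using rot_iff ij by (metis rot_eq_iff cong_sym cong_trans)
    then show False
    proof cases
      case 2
      then have "[c = 0] (mod int n)"
        using cong_diff[OF 2 cong_refl[of c]] by simp
      then show False
        using assms(3) by (simp add: rot_zero[symmetric] rot_eq_iff)
    qed (use no in blast)
  qed
  have 3: "rot (i - j) \<notin> ?T" if "mir i \<in> S" "mir j \<in> S" for i j
  proof
    assume "rot (i - j) \<in> ?T"
    then have "[i - j = c] (mod int n)"
      using product_freeD(2)[OF pf that] rot_iff by blast
    from cong_add[OF this cong_refl[of j]] have "mir (c + j) = mir i"
      by (simp add: mir_eq_iff cong_sym)
    then show False
      using no that by metis
  qed
  have "product_free G ?T"
    unfolding product_free_iff mir_iff
    using sub 1 2 3 rot_iff by (metis add.commute rot_closed insert_not_empty insert_subset)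
  then show False
    using assms by (auto simp: locally_maximal_product_free_def)
qed

lemma unfilled_rotation:
  assumes lm: "locally_maximal_product_free G S" and "\<not> fills G S"
  obtains c where "rot c \<noteq> \<one>" "rot c \<notin> S" "rot c \<notin> S <#> S"
proof -
  obtain g where g: "g \<in> carrier G" "g \<noteq> \<one>" "g \<notin> S" "g \<notin> S <#> S"
    using assms(2) by (auto simp: fills_def)
  have "g \<noteq> mir i" for i
    using reflection_cover[OF lm] mir_mem_squareI g by metis
  then show ?thesis
    using g that by (auto simp: carrier_eq)
qed

end

section \<open>Product-free sets that cannot be completed to filling ones\<close>

text \<open>
  Finiteness provides a maximal product-free set above \<open>S\<close>, and this one misses \<open>g\<close>.
\<close>

lemma not_filledI:
  assumes fin: "finite (carrier G)" and pf: "product_free G S"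
    and g: "g \<in> carrier G" "g \<noteq> \<one>\<^bsub>G\<^esub>"
    and miss: "\<And>T. product_free G T \<Longrightarrow> S \<subseteq> T \<Longrightarrow> g \<notin> T \<union> (T <#>\<^bsub>G\<^esub> T)"
  shows "\<not> filled_group G"
proof -
  let ?\<T> = "{T. product_free G T \<and> S \<subseteq> T}"
  have "?\<T> \<subseteq> Pow (carrier G)"
    by (auto simp: product_free_def)
  then have "finite ?\<T>"
    using fin by (meson finite_Pow_iff finite_subset)
  then obtain T where T: "T \<in> ?\<T>" "\<And>T'. T' \<in> ?\<T> \<Longrightarrow> T \<subseteq> T' \<Longrightarrow> T = T'"
    using finite_has_maximal2[of ?\<T> S] pf by auto
  then have "locally_maximal_product_free G T"
    by (auto simp: locally_maximal_product_free_def)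
  moreover have "\<not> fills G T"
    using miss[of T] T g by (auto simp: fills_def)
  ultimately show ?thesis
    by (auto simp: filled_group_def)
qed

context dihedral_coordinates
begin

text \<open>
  The sets \<open>A\<close> and \<open>B\<close> bound the rotations and the reflections of every product-free set
  above \<open>S\<close>. If \<open>c\<close> is out of reach for these bounds, it is missed by all of those sets.
\<close>

lemma not_filled_if_confined:
  assumes pf: "product_free G S"
    and A: "\<And>T i. product_free G T \<Longrightarrow> S \<subseteq> T \<Longrightarrow> rot i \<in> T \<Longrightarrow> i mod int n \<in> A"
    and B: "\<And>T i. product_free G T \<Longrightarrow> S \<subseteq> T \<Longrightarrow> mir i \<in> T \<Longrightarrow> i mod int n \<in> B"
    and c: "c \<in> {1..<int n}" "c \<notin> A"
    and AA: "\<And>p q. p \<in> A \<Longrightarrow> q \<in> A \<Longrightarrow> (p + q) mod int n \<noteq> c"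
    and BB: "\<And>p q. p \<in> B \<Longrightarrow> q \<in> B \<Longrightarrow> (p - q) mod int n \<noteq> c"
  shows "\<not> filled_group G"
proof (rule not_filledI[OF finite_carrier pf rot_closed])
  have c_mod: "c mod int n = c"
    using c by simp
  show "rot c \<noteq> \<one>"
    using c by (auto simp: rot_zero[symmetric] rot_eq_iff cong_def)
  fix T assume T: "product_free G T" "S \<subseteq> T"
  have "rot c \<notin> T"
    using A[OF T, of c] c c_mod by auto
  moreover have "\<not> (rot i \<in> T \<and> rot (c - i) \<in> T)" for i
    using A[OF T, of i] A[OF T, of "c - i"] AA[of "i mod int n" "(c - i) mod int n"] c_mod
    by (auto simp: mod_simps)
  moreover have "\<not> (mir i \<in> T \<and> mir (c + i) \<in> T)" for i
    using B[OF T, of i] B[OF T, of "c + i"] BB[of "(c + i) mod int n" "i mod int n"] c_mod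
    by (auto simp: mod_simps)
  moreover have "T \<subseteq> carrier G"
    using T by (simp add: product_free_def)
  ultimately show "rot c \<notin> T \<union> (T <#> T)"
    by (simp add: rot_mem_square_iff)
qed

lemma product_free_residues:
  assumes "A \<subseteq> {0..<int n}" "B \<subseteq> {0..<int n}" and "A \<noteq> {}"
    and AA: "\<And>p q. p \<in> A \<Longrightarrow> q \<in> A \<Longrightarrow> (p + q) mod int n \<notin> A"
    and BB: "\<And>p q. p \<in> B \<Longrightarrow> q \<in> B \<Longrightarrow> (p - q) mod int n \<notin> A"
  shows "product_free G (rot ` A \<union> mir ` B)"
proof -
  have mod_A: "p mod int n = p" if "p \<in> A" for p
    using assms(1) that by auto
  have mod_B: "p mod int n = p" if "p \<in> B" for p
    using assms(2) that by auto
  have rot_iff: "rot i \<in> rot ` A \<union> mir ` B \<longleftrightarrow> i mod int n \<in> A" for i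
    using mod_A rot_neq_mir by (auto simp: rot_eq_iff cong_def image_iff)
  have mir_iff: "mir i \<in> rot ` A \<union> mir ` B \<longleftrightarrow> i mod int n \<in> B" for i
  proof -
    have "mir i \<notin> rot ` A"
      using rot_neq_mir by (metis imageE)
    then show ?thesis
      using mod_B by (auto simp: mir_eq_iff cong_def image_iff)
  qed
  have "(i + j) mod int n \<notin> A" if "i mod int n \<in> A" "j mod int n \<in> A" for i j
    using AA[OF that] by (simp add: mod_add_eq)
  moreover have "(i - j) mod int n \<notin> A" if "i mod int n \<in> B" "j mod int n \<in> B" for i j
    using BB[OF that] by (simp add: mod_diff_eq)
  moreover have "rot ` A \<union> mir ` B \<subseteq> carrier G"
    by auto
  ultimately show ?thesis
    unfolding product_free_iff rot_iff mir_iff using assms(3) by blast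
qed

text \<open>
  The set consists of the rotations in the upper half \<open>[l, m)\<close> of \<open>[0, m)\<close> and of the two
  reflections \<open>0\<close> and \<open>m\<close>; it prevents all its product-free extensions from reaching the rotation
  \<open>1 + e\<close>. The lower bound on \<open>m\<close> says that \<open>1 + e\<close> is a difference of two elements of
  \<open>[l, m)\<close>.
\<close>

lemma not_filled_generic:
  fixes m e :: int
  assumes n: "int n = 2 * m + e" and e: "e \<in> {0, 1}" and m: "m \<ge> 4 + 2 * e"
  shows "\<not> filled_group G"
proof -
  define l where "l = (m + 1) div 2"
  have l: "m \<le> 2 * l" "2 * l \<le> m + 1"
    by (auto simp: l_def)
  let ?A = "{l..<m}" and ?B = "{0, m}"
  let ?S = "rot ` ?A \<union> mir ` ?B"
  have mod_add: "(p + q) mod int n = (if p + q < int n then p + q else p + q - int n)"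
    and mod_diff: "(p - q) mod int n = (if q \<le> p then p - q else p - q + int n)"
    if "p \<in> {0..<int n}" "q \<in> {0..<int n}" for p q
    using that mod_pos_pos_trivial[of "p + q - int n" "int n"]
      mod_pos_pos_trivial[of "p - q + int n" "int n"] by auto
  show ?thesis
  proof (rule not_filled_if_confined[where A = "{m - l..<m}" and c = "1 + e"
        and B = "{0, m, m + e, 2 * m} \<inter> {0..<int n}"])
    show "product_free G ?S"
    proof (rule product_free_residues)
      show "(p + q) mod int n \<notin> ?A" if "p \<in> ?A" "q \<in> ?A" for p q
        using that l m e n mod_add[of p q] by (auto split: if_splits)
      show "(p - q) mod int n \<notin> ?A" if "p \<in> ?B" "q \<in> ?B" for p q
        using that l m e n mod_diff[of p q] by (auto split: if_splits)
    qed (use l m e n in auto)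
  next
    fix T i assume T: "product_free G T" "?S \<subseteq> T" and i: "rot i \<in> T"
    have rot_T: "rot k \<in> T" if "k \<in> ?A" for k
      using T that by auto
    have diff: "rot k \<notin> T" if "\<bar>k\<bar> \<le> m - 1 - l" for k
    proof (cases "k \<ge> 0")
      case True
      then show ?thesis
        using product_freeD(1)[OF T(1), of l k] rot_T[of l] rot_T[of "l + k"] that by auto
    next
      case False
      then show ?thesis
        using product_freeD(1)[OF T(1), of "l - k" k] rot_T[of l] rot_T[of "l - k"] that by auto
    qed
    have sum: "rot k \<notin> T" if "2 * l \<le> k" "k \<le> 2 * m - 2" for k
    proof -
      define p where "p = max l (k - (m - 1))"
      have "p \<in> ?A" "k - p \<in> ?A"
        using that l m e by (auto simp: p_def)
      then show ?thesis
        using product_freeD(1)[OF T(1), of p "k - p"] rot_T by simp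
    qed
    have mid: "rot m \<notin> T"
      using product_freeD(2)[OF T(1), of m 0] T(2) by auto
    define p where "p = i mod int n"
    have p: "0 \<le> p" "p < int n" "rot p \<in> T"
      using n_pos i by (simp_all add: p_def)
    \<comment> \<open>From above, \<open>p\<close> is pushed below \<open>m\<close>: near \<open>n\<close> it is a small negative number, hence
      a difference of elements of \<open>[l, m)\<close>; from \<open>2 * l\<close> on it is a sum of two of them;
      and \<open>m\<close>, the only value that may remain, is the difference of the two reflections.\<close>
    have "rot (p - int n) = rot p"
      by (simp add: rot_eq_iff cong_iff_dvd_diff)
    then have "\<not> p - int n \<ge> - (m - 1 - l)"
      using diff[of "p - int n"] p by auto
    then have "p \<le> 2 * m - 2"
      using n e m l by auto
    then have "p < 2 * l"
      using sum[of p] p by fastforce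
    then have "p < m"
      using mid p l by (cases "p = m") auto
    moreover have "\<not> p \<le> m - 1 - l"
      using diff[of p] p by auto
    ultimately show "i mod int n \<in> {m - l..<m}"
      by (simp add: p_def[symmetric])
  next
    fix T i assume T: "product_free G T" "?S \<subseteq> T" and i: "mir i \<in> T"
    have mir_T: "mir 0 \<in> T" "mir m \<in> T"
      using T by auto
    have rot_T: "rot k \<in> T" if "k \<in> ?A" for k
      using T that by auto
    \<comment> \<open>A reflection at a distance in \<open>[l, m)\<close> from \<open>0\<close> or \<open>m\<close>, in either direction, is excluded.
      These four intervals leave only the positions at or next to \<open>0\<close> and \<open>m\<close>.\<close>
    have no: "mir k \<notin> T \<and> mir (m + k) \<notin> T \<and> mir (m - k) \<notin> T \<and> mir (int n - k) \<notin> T" if k: "k \<in> ?A" for k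
    proof -
      have "mir (int n - k) = mir (- k)"
        by (simp add: mir_eq_iff cong_iff_dvd_diff)
      then show ?thesis
        using product_freeD(2)[OF T(1), of k 0] product_freeD(2)[OF T(1), of "m + k" m]
          product_freeD(2)[OF T(1), of m "m - k"] product_freeD(2)[OF T(1), of 0 "- k"]
          mir_T rot_T[OF k] by auto
    qed
    define p where "p = i mod int n"
    have p: "0 \<le> p" "p < int n" "mir p \<in> T"
      using n_pos i by (simp_all add: p_def)
    have "p \<notin> ?A" "p - m \<notin> ?A" "m - p \<notin> ?A" "int n - p \<notin> ?A"
      using no[of p] no[of "p - m"] no[of "m - p"] no[of "int n - p"] p(3)
      by (auto simp del: atLeastLessThan_iff)
    then have "p = 0 \<or> p = m \<or> p = m + e \<or> p = 2 * m"
      using p(1,2) n e l m unfolding atLeastLessThan_iff insert_iff empty_iff by (smt (verit))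
    then show "i mod int n \<in> {0, m, m + e, 2 * m} \<inter> {0..<int n}"
      unfolding p_def[symmetric] using p(1,2) by auto
  next
    show "(p + q) mod int n \<noteq> 1 + e" if "p \<in> {m - l..<m}" "q \<in> {m - l..<m}" for p q
      using that l m e n mod_add[of p q] by auto
  next
    show "(p - q) mod int n \<noteq> 1 + e"
      if "p \<in> {0, m, m + e, 2 * m} \<inter> {0..<int n}" "q \<in> {0, m, m + e, 2 * m} \<inter> {0..<int n}"
      for p q
      using that m e n mod_diff[of p q] by auto
  qed (use l m e n in auto)
qed

text \<open>
  For \<open>n = 9\<close> the interval \<open>[l, m)\<close> of the general construction is \<open>{2, 3}\<close>, too short to
  have \<open>2\<close> as a difference. The set used instead admits neither \<open>rot 1\<close> nor \<open>rot 8\<close>, because it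
  contains their squares \<open>rot 2\<close> and \<open>rot 7\<close>. All other nontrivial rotations and all reflections
  belong to the set or are products of two of its elements, so no product-free set is larger.
\<close>

lemma not_filled_nine:
  assumes n: "n = 9"
  shows "\<not> filled_group G"
proof -
  have le: "i \<in> {0..<9} \<longleftrightarrow> i \<in> {0, 1, 2, 3, 4, 5, 6, 7, 8}" for i :: int
    by auto
  let ?S = "rot ` {2, 7} \<union> mir ` {0, 3, 6}"
  show ?thesis
  proof (rule not_filled_if_confined[where A = "{2, 7}" and B = "{0, 3, 6}" and c = 1])
    show "product_free G ?S"
      by (rule product_free_residues) (use n in auto)
  next
    fix T i assume T: "product_free G T" "?S \<subseteq> T" and i: "rot i \<in> T"
    define p where "p = i mod int n"
    have p: "p \<in> {0..<9}"
      using n by (simp add: p_def)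
    have "rot p \<in> T"
      using i by (simp add: p_def)
    have mod9: "rot 14 = rot 5" "rot 16 = rot 7"
      using n by (simp_all add: rot_eq_iff cong_def)
    have "rot 0 \<notin> T" "rot 1 \<notin> T" "rot 3 \<notin> T" "rot 4 \<notin> T" "rot 5 \<notin> T" "rot 6 \<notin> T" "rot 8 \<notin> T"
      using T(2) mod9 product_freeD(1)[OF T(1), of 0 0] product_freeD(1)[OF T(1), of 1 1]
        product_freeD(1)[OF T(1), of 2 2] product_freeD(1)[OF T(1), of 7 7]
        product_freeD(1)[OF T(1), of 8 8] product_freeD(2)[OF T(1), of 3 0]
        product_freeD(2)[OF T(1), of 6 0] by auto
    then show "i mod int n \<in> {2, 7}"
      using p \<open>rot p \<in> T\<close> unfolding p_def[symmetric] le by auto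
  next
    fix T i assume T: "product_free G T" "?S \<subseteq> T" and i: "mir i \<in> T"
    define p where "p = i mod int n"
    have p: "p \<in> {0..<9}"
      using n by (simp add: p_def)
    have "mir p \<in> T"
      using i by (simp add: p_def)
    have "mir 1 \<notin> T" "mir 2 \<notin> T" "mir 4 \<notin> T" "mir 5 \<notin> T" "mir 7 \<notin> T" "mir 8 \<notin> T"
      using T(2) product_freeD(2)[OF T(1), of 3 1] product_freeD(2)[OF T(1), of 2 0]
        product_freeD(2)[OF T(1), of 6 4] product_freeD(2)[OF T(1), of 5 3]
        product_freeD(2)[OF T(1), of 7 0] product_freeD(2)[OF T(1), of 8 6] by auto
    then show "i mod int n \<in> {0, 3, 6}"
      using p \<open>mir p \<in> T\<close> unfolding p_def[symmetric] le by auto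
  qed (use n in auto)
qed

end

section \<open>The six filled groups\<close>

text \<open>
  The predicates \<open>a\<close> and \<open>b\<close> describe the rotations and reflections of a locally maximal
  product-free set that contains \<open>mir 0\<close> and misses the rotation \<open>c\<close>: the clauses express, in this
  order, product-freeness, maximality with respect to reflections and to rotations, and that
  \<open>c\<close> is neither in the set nor a product. All quantifiers are bounded and all indices
  reduced, so that for numerals \<open>n\<close> and \<open>c\<close> the condition is a propositional formula.
\<close>

definition has_hole :: "int \<Rightarrow> int \<Rightarrow> (int \<Rightarrow> bool) \<Rightarrow> (int \<Rightarrow> bool) \<Rightarrow> bool"
  where "has_hole n c a b \<longleftrightarrow>
    (\<forall>i\<in>{0..<n}. a i \<longrightarrow> (\<forall>j\<in>{0..<n}. a j \<longrightarrow> \<not> a ((i + j) mod n))) \<and>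
    (\<forall>i\<in>{0..<n}. b i \<longrightarrow> (\<forall>j\<in>{0..<n}. b j \<longrightarrow> \<not> a ((i - j) mod n))) \<and>
    (\<forall>i\<in>{0..<n}. b i \<or> (\<exists>j\<in>{0..<n}. a j \<and> (b ((i - j) mod n) \<or> b ((i + j) mod n)))) \<and>
    (\<forall>i\<in>{1..<n}. a i \<or> a (2 * i mod n) \<or>
      (\<exists>j\<in>{0..<n}. a j \<and> (a ((i - j) mod n) \<or> a ((i + j) mod n))) \<or>
      (\<exists>j\<in>{0..<n}. b j \<and> b ((i + j) mod n))) \<and>
    b 0 \<and> \<not> a c \<and>
    (\<forall>i\<in>{0..<n}. a i \<longrightarrow> \<not> a ((c - i) mod n)) \<and>
    (\<forall>i\<in>{0..<n}. b i \<longrightarrow> \<not> b ((c + i) mod n))"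

context dihedral_coordinates
begin

lemma has_holeI:
  assumes lm: "locally_maximal_product_free G S" and "mir 0 \<in> S"
    and c: "rot c \<notin> S" "rot c \<notin> S <#> S"
  shows "has_hole (int n) c (\<lambda>i. rot i \<in> S) (\<lambda>i. mir i \<in> S)"
proof -
  have pf: "product_free G S"
    using lm by (simp add: locally_maximal_product_free_def)
  then have "S \<subseteq> carrier G"
    by (simp add: product_free_def)
  note c = c(1) c(2)[unfolded rot_mem_square_iff[OF this]]
  have mod_rot: "rot (i + j mod int n) = rot (i + j)" "rot (i - j mod int n) = rot (i - j)"
    and mod_mir: "mir (i + j mod int n) = mir (i + j)" "mir (i - j mod int n) = mir (i - j)" for i j
    unfolding rot_eq_iff mir_eq_iff by (simp_all add: cong_def mod_simps)
  have I: "(\<exists>j\<in>{0..<int n}. P j) \<longleftrightarrow> (\<exists>j. P j)" if "\<And>j. P (j mod int n) \<longleftrightarrow> P j" for P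
    using n_pos that by (metis atLeastLessThan_iff of_nat_0_less_iff pos_mod_bound pos_mod_sign)
  have E: "(\<exists>j\<in>{0..<int n}. rot j \<in> S \<and> (mir (i - j) \<in> S \<or> mir (i + j) \<in> S)) \<longleftrightarrow>
      (\<exists>j. rot j \<in> S \<and> (mir (i - j) \<in> S \<or> mir (i + j) \<in> S))"
    "(\<exists>j\<in>{0..<int n}. rot j \<in> S \<and> (rot (i - j) \<in> S \<or> rot (i + j) \<in> S)) \<longleftrightarrow>
      (\<exists>j. rot j \<in> S \<and> (rot (i - j) \<in> S \<or> rot (i + j) \<in> S))"
    "(\<exists>j\<in>{0..<int n}. mir j \<in> S \<and> mir (i + j) \<in> S) \<longleftrightarrow> (\<exists>j. mir j \<in> S \<and> mir (i + j) \<in> S)" for i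
    by (rule I; simp add: mod_rot mod_mir)+
  have "rot i \<noteq> \<one>" if "i \<in> {1..<int n}" for i
    using that by (auto simp: rot_zero[symmetric] rot_eq_iff cong_def)
  then show ?thesis
    unfolding has_hole_def rot_mod mir_mod E
    using product_freeD[OF pf] reflection_cover[OF lm] rotation_cover[OF lm] assms(2) c by blast
qed

end

text \<open>
  Used as a rewrite rule, this enumerates an interval between numerals.
\<close>

lemma interval_insert: "i < j \<Longrightarrow> {i..<j::int} = insert i {i + 1..<j}"
  by auto

lemma no_hole:
  "\<not> has_hole 3 1 a b"
  "\<not> has_hole 4 1 a b" "\<not> has_hole 4 2 a b"
  "\<not> has_hole 5 1 a b"
  "\<not> has_hole 6 1 a b" "\<not> has_hole 6 2 a b" "\<not> has_hole 6 3 a b"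
  "\<not> has_hole 7 1 a b"
  "\<not> has_hole 11 1 a b"
  by (simp add: has_hole_def interval_insert; satx)+

text \<open>
  Multiplication by a unit \<open>k\<close> of the residue ring comes from an automorphism of the
  group, so only one representative \<open>d\<close> of each orbit of units has to be considered.
\<close>

lemma coprime_multiple_of_divisor:
  assumes "n \<in> {3, 4, 5, 6, 7, 11}" and "c \<in> {1..<int n}"
  obtains k d where "coprime k (int n)" "[c = k * d] (mod int n)"
    "(n, d) \<in> {(3, 1), (4, 1), (4, 2), (5, 1), (6, 1), (6, 2), (6, 3), (7, 1), (11, 1)}"
proof -
  consider "n \<in> {3, 5, 7, 11}" | "n = 4" | "n = 6"
    using assms(1) by blast
  then show ?thesis
  proof cases
    case 1
    then have "Factorial_Ring.prime (int n)"
      by auto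
    moreover have "\<not> int n dvd c"
      using assms(2) by (auto dest: zdvd_imp_le)
    ultimately have "coprime c (int n)"
      using prime_imp_coprime coprime_commute by blast
    then show ?thesis
      using 1 by (intro that[of c 1]) auto
  next
    case 2
    then consider "c = 1" | "c = 2" | "c = 3"
      using assms(2) by fastforce
    then show ?thesis
      using 2 that[of 1 c] that[of "- 1" 1] by cases (simp_all add: cong_def)
  next
    case 3
    then consider "c = 1" | "c = 2" | "c = 3" | "c = 4" | "c = 5"
      using assms(2) by fastforce
    then show ?thesis
      using 3 that[of 1 c] that[of "- 1" "6 - c"] by cases (simp_all add: cong_def)
  qed
qed

lemma (in dihedral_coordinates) filled_small:
  assumes n: "n \<in> {3, 4, 5, 6, 7, 11}"
  shows "filled_group G"
  unfolding filled_group_def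
proof (intro allI impI, rule ccontr)
  fix S assume lm: "locally_maximal_product_free G S" and "\<not> fills G S"
  then obtain c0 where c0: "rot c0 \<noteq> \<one>" "rot c0 \<notin> S" "rot c0 \<notin> S <#> S"
    by (rule unfilled_rotation)
  define c where "c = c0 mod int n"
  have c: "rot c \<notin> S" "rot c \<notin> S <#> S"
    using c0 by (simp_all add: c_def)
  have "c0 mod int n \<noteq> 0"
    using c0 by (auto simp: rot_zero[symmetric] rot_eq_iff cong_def)
  then have "c \<in> {1..<int n}"
    using n_pos pos_mod_bound[of "int n" c0] pos_mod_sign[of "int n" c0]
    unfolding c_def by (simp del: pos_mod_bound pos_mod_sign)
  then obtain k d where kd: "coprime k (int n)" "[c = k * d] (mod int n)"
    "(n, d) \<in> {(3, 1), (4, 1), (4, 2), (5, 1), (6, 1), (6, 2), (6, 3), (7, 1), (11, 1)}"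
    by (rule coprime_multiple_of_divisor[OF n])
  obtain t where t: "mir t \<in> S"
    using reflection_cover[OF lm, of 0] by blast
  \<comment> \<open>In the new coordinates the missed rotation has index \<open>d\<close>, and \<open>mir t\<close> has index \<open>0\<close>.\<close>
  interpret new: dihedral_coordinates G n "\<lambda>i. rot (k * i)" "\<lambda>i. mir (k * i + t)"
    by (rule change_coordinates) fact
  have "rot (k * d) = rot c"
    using kd by (simp add: rot_eq_iff cong_sym)
  then have "has_hole (int n) d (\<lambda>i. rot (k * i) \<in> S) (\<lambda>i. mir (k * i + t) \<in> S)"
    using lm t c by (intro new.has_holeI) simp_all
  then show False
    using kd(3) no_hole by auto
qed

section \<open>The classification\<close>

theorem theorem2p4:
  fixes n :: nat and G :: "('a, 'b) monoid_scheme"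
  assumes "n > 2" and "is_dihedral n G"
  shows "filled_group G \<longleftrightarrow> n \<in> {3, 4, 5, 6, 7, 11}"
proof -
  obtain rot mir where "dihedral_coordinates G n rot mir"
    using is_dihedral_coordinates[of n G] assms by auto
  then interpret dihedral_coordinates G n rot mir .
  show ?thesis
  proof
    assume filled: "filled_group G"
    show "n \<in> {3, 4, 5, 6, 7, 11}"
    proof (rule ccontr)
      assume n: "n \<notin> {3, 4, 5, 6, 7, 11}"
      define m e where "m = int n div 2" and "e = int n mod 2"
      have "int n = 2 * m + e" "e \<in> {0, 1}"
        by (auto simp: m_def e_def)
      moreover from this have "m \<ge> 4 + 2 * e" if "n \<noteq> 9"
        using n that assms(1) by auto presburger+
      ultimately show False
        using filled not_filled_generic not_filled_nine by blast
    qed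
  qed (rule filled_small)
qed

end
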